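(* Let $\lambda$ be an infinite cardinal and let $\kappa=(2^\lambda)^+$. Then there is a graph $G_\kappa$ of cardinality $\kappa$ such that $G_\kappa\rightarrow(\mathcal{T}(\kappa))^2_\lambda$; that is, for every colouring $c:E(G_\kappa)\to\lambda$ of the edges of $G_\kappa$ with $\lambda$ colours, there is an induced subgraph of $G_\kappa$ isomorphic to $\mathcal{T}(\kappa)$ all of whose edges receive the same colour under $c$.
   Context: A graph is a pair $(V,E)$ with $E\subseteq[V]^2$. A subgraph $(W,F)$ of $(V,E)$ is induced if $F=E\cap[W]^2$. Let ${}^{<\omega}\kappa$ denote the set of all finite strictly increasing sequences of ordinals less than $\kappa$ (including the empty sequence). For $s,t\in{}^{<\omega}\kappa$, write $s\lhd t$ if $s$ is a proper initial segment of $t$. The transitive $\kappa$-tree of height $\omega$, $\mathcal{T}(\kappa)$, is the graph with vertex set ${}^{<\omega}\kappa$ and edge set $\{\{s,t\}: s,t\in{}^{<\omega}\kappa,\ s\lhd t\}$. *)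

theory Defs
  imports Main "HOL-Library.Ramsey" "HOL-Library.Sublist"
begin

unbundle cardinal_syntax

(* A graph is a pair (V, E) with E a subset of [V]^2, the two-element subsets of V. *)
type_synonym 'a graph = "'a set \<times> 'a set set"

abbreviation verts :: "'a graph \<Rightarrow> 'a set" where
  "verts G \<equiv> fst G"

abbreviation edges :: "'a graph \<Rightarrow> 'a set set" where
  "edges G \<equiv> snd G"

definition is_graph :: "'a graph \<Rightarrow> bool" where
  "is_graph G \<longleftrightarrow> edges G \<subseteq> [verts G]\<^bsup>2\<^esup>"

definition induced_subgraph :: "'a graph \<Rightarrow> 'a graph \<Rightarrow> bool" where
  "induced_subgraph H G \<longleftrightarrow>
     verts H \<subseteq> verts G \<and> edges H = edges G \<inter> [verts H]\<^bsup>2\<^esup>"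

definition isomorphic :: "'a graph \<Rightarrow> 'b graph \<Rightarrow> bool" where
  "isomorphic G H \<longleftrightarrow>
     (\<exists>f. bij_betw f (verts G) (verts H) \<and>
       (\<forall>u\<in>verts G. \<forall>v\<in>verts G. {u, v} \<in> edges G \<longleftrightarrow> {f u, f v} \<in> edges H))"

(* A cardinal is a well-order k with Card_order k.  The elements of Field k, ordered by k,
   stand for the ordinals below the cardinal; k itself is reflexive, hence k - Id. *)
definition incr_seqs :: "'k rel \<Rightarrow> 'k list set" where
  "incr_seqs k = {s. set s \<subseteq> Field k \<and> sorted_wrt (\<lambda>x y. (x, y) \<in> k - Id) s}"

definition transitive_tree :: "'k rel \<Rightarrow> 'k list graph" where
  "transitive_tree k =
     (incr_seqs k, {{s, t} | s t. s \<in> incr_seqs k \<and> t \<in> incr_seqs k \<and> strict_prefix s t})"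

(* The arrow relation G --> (T)^2_l for edge colourings with colours in Field l; only the
   values of a colouring on edges of G matter. *)
definition arrows :: "'v graph \<Rightarrow> 'w graph \<Rightarrow> 'l rel \<Rightarrow> bool" where
  "arrows G T l \<longleftrightarrow>
     (\<forall>c :: 'v set \<Rightarrow> 'l. c ` edges G \<subseteq> Field l \<longrightarrow>
       (\<exists>H. induced_subgraph H G \<and> isomorphic H T \<and>
         (\<exists>a\<in>Field l. \<forall>e\<in>edges H. c e = a)))"

end

theory Submission
  imports Defs
begin

text \<open>Write \<open>\<mu> = 2\<^sup>\<lambda>\<close> and \<open>\<kappa> = \<mu>\<^sup>+\<close>. Fix for every ordinal \<open>d < \<kappa>\<close> of cofinality
  \<open>\<lambda>\<^sup>+\<close> a cofinal ladder \<open>A d\<close> of type \<open>\<lambda>\<^sup>+\<close>. The vertices of the graph are the pairs \<open>(lo, hi)\<close> of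
  ordinals below \<open>\<kappa>\<close>, and \<open>x\<close> is joined to a later \<open>t\<close> (\<open>hi x < lo t\<close>) if the ladder of \<open>lo t\<close> meets
  the interval \<open>[lo x, hi x)\<close>. As \<open>\<mu>\<^sup>\<lambda> = \<mu>\<close>, an Erdos--Rado style argument, relative to a normal
  ideal, gives a colour \<open>a\<close> and a positive set \<open>W\<close> such that every suitable set \<open>X\<close> with \<open>X \<inter> W\<close>
  positive contains a vertex with a positive set of \<open>a\<close>-coloured later neighbours in \<open>X \<inter> W\<close>; so
  homogeneous chains can be prolonged.

  To make incomparable nodes nonadjacent, one uses that no ladder has a limit of cofinality
  \<open>\<lambda>\<^sup>+\<close> below its top. Hence every positive set contains, for some \<open>e\<close> and every \<open>n\<close>, positively many
  vertices whose ladders avoid \<open>[e, n)\<close>. Choosing each new node so that its ladder jumps over all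
  intervals used since its parent was chosen yields an induced copy of the tree.\<close>

subsection \<open>Ladder systems and positive sets\<close>

text \<open>Abstracts the successor cardinal of \<open>m\<close>. It is used twice: for \<kappa>
  itself, with \<open>m\<close> equal to \<open>2\<^sup>\<lambda>\<close>, and for the order
  \<open>\<lambda>\<^sup>+\<close> that indexes the ladders.\<close>

locale regular_order =
  fixes K :: "'k set" and lt :: "'k \<Rightarrow> 'k \<Rightarrow> bool" (infix "\<sqsubset>" 50) and m :: "'m rel"
  assumes irrefl: "\<not> x \<sqsubset> x"
    and trans: "x \<sqsubset> y \<Longrightarrow> y \<sqsubset> z \<Longrightarrow> x \<sqsubset> z"
    and total: "x \<in> K \<Longrightarrow> y \<in> K \<Longrightarrow> x \<sqsubset> y \<or> x = y \<or> y \<sqsubset> x"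
    and lt_in: "x \<sqsubset> y \<Longrightarrow> x \<in> K \<and> y \<in> K"
    and wf_lt: "wf {(x, y). x \<sqsubset> y}"
    and bounded: "X \<subseteq> K \<Longrightarrow> |X| \<le>o m \<Longrightarrow> \<exists>b\<in>K. \<forall>x\<in>X. x \<sqsubset> b"
    and segment: "|{x. x \<sqsubset> b}| \<le>o m"
    and m_card: "Card_order m"
    and m_inf: "infinite (Field m)"
begin

section \<open>Strict bounds and small sets in a regular well-order\<close>

abbreviation le (infix "\<sqsubseteq>" 50) where "x \<sqsubseteq> y \<equiv> x \<sqsubset> y \<or> x = y"

definition ub :: "'k set \<Rightarrow> 'k" where
  "ub X = (SOME b. b \<in> K \<and> (\<forall>x\<in>X. x \<sqsubset> b))"

lemma ub:
  assumes "X \<subseteq> K" "|X| \<le>o m"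
  shows "ub X \<in> K" and "x \<in> X \<Longrightarrow> x \<sqsubset> ub X"
proof -
  have "\<exists>b. b \<in> K \<and> (\<forall>x\<in>X. x \<sqsubset> b)"
    using bounded[OF assms] by blast
  from someI_ex[OF this] show "ub X \<in> K" "x \<in> X \<Longrightarrow> x \<sqsubset> ub X"
    by (auto simp: ub_def)
qed

lemma not_lt: "x \<in> K \<Longrightarrow> y \<in> K \<Longrightarrow> \<not> x \<sqsubset> y \<longleftrightarrow> y \<sqsubseteq> x"
  using total irrefl trans by blast

lemma finite_small: "finite X \<Longrightarrow> |X| \<le>o m"
  using finite_ordLess_infinite[OF card_of_Well_order card_order_on_well_order_on[OF m_card] _ m_inf]
    ordLess_imp_ordLeq Field_card_of by metis

lemma UN_small: "|I| \<le>o m \<Longrightarrow> (\<And>i. i \<in> I \<Longrightarrow> |X i| \<le>o m) \<Longrightarrow> |\<Union>i\<in>I. X i| \<le>o m"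
  using card_of_UNION_ordLeq_infinite_Field[OF m_inf m_card] by blast

lemma image_small: "|X| \<le>o m \<Longrightarrow> |f ` X| \<le>o m"
  using card_of_image ordLeq_transitive by blast

lemma subset_small: "|Y| \<le>o m \<Longrightarrow> X \<subseteq> Y \<Longrightarrow> |X| \<le>o m"
  using card_of_mono1 ordLeq_transitive by blast

lemma down_small: "|{x. x \<sqsubseteq> b}| \<le>o m"
proof -
  have "{x. x \<sqsubseteq> b} = (\<Union>X\<in>{{x. x \<sqsubset> b}, {b}}. X)" by auto
  moreover have "|\<Union>X\<in>{{x. x \<sqsubset> b}, {b}}. X| \<le>o m"
    by (rule UN_small) (auto intro: finite_small segment)
  ultimately show ?thesis by simp
qed

lemma max_le: "x \<in> K \<Longrightarrow> y \<in> K \<Longrightarrow> \<exists>z\<in>{x, y}. x \<sqsubseteq> z \<and> y \<sqsubseteq> z"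
  using total by blast

lemma le_lt_trans: "x \<sqsubseteq> y \<Longrightarrow> y \<sqsubset> z \<Longrightarrow> x \<sqsubset> z"
  using trans by blast

end

text \<open>\<open>S\<close> stands for the points of cofinality \<open>\<lambda>\<^sup>+\<close>,
  and \<open>S_closed\<close> for its stationarity. The order type of the ladders enters in
  \<open>ladder_bounded\<close>: a proper initial part of a ladder has at most \<lambda> elements,
  too few to be cofinal in a point of \<open>S\<close>.\<close>

locale ladder_system = regular_order K lt m
  for K :: "'k set" and lt :: "'k \<Rightarrow> 'k \<Rightarrow> bool" (infix "\<sqsubset>" 50) and m :: "'m rel" +
  fixes S :: "'k set" and A :: "'k \<Rightarrow> 'k set" and l :: "'l rel"
  assumes S_in: "S \<subseteq> K"
    and ladder_lt: "d \<in> S \<Longrightarrow> z \<in> A d \<Longrightarrow> z \<sqsubset> d"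
    and ladder_unbounded: "d \<in> S \<Longrightarrow> x \<sqsubset> d \<Longrightarrow> \<exists>z\<in>A d. x \<sqsubseteq> z"
    and ladder_bounded: "d \<in> S \<Longrightarrow> e \<in> S \<Longrightarrow> e \<sqsubset> d \<Longrightarrow> \<exists>x. x \<sqsubset> e \<and> (\<forall>z\<in>A d. z \<sqsubset> e \<longrightarrow> z \<sqsubset> x)"
    and S_cof: "d \<in> S \<Longrightarrow> Z \<subseteq> {x. x \<sqsubset> d} \<Longrightarrow> |Z| \<le>o l \<Longrightarrow> \<exists>x. x \<sqsubset> d \<and> (\<forall>z\<in>Z. z \<sqsubset> x)"
    and S_closed: "(\<And>x. x \<in> K \<Longrightarrow> f x \<in> K) \<Longrightarrow> \<exists>d\<in>S. \<forall>x. x \<sqsubset> d \<longrightarrow> f x \<sqsubset> d"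

text \<open>Identifying \<open>K\<close> with its square lets single elements of \<open>K\<close>
  code the vertices; the same coding later yields the parents in a tree of stages.\<close>

locale laddered_order = ladder_system K lt m S A l
  for K :: "'k set" and lt :: "'k \<Rightarrow> 'k \<Rightarrow> bool" (infix "\<sqsubset>" 50) and m :: "'m rel"
    and S :: "'k set" and A :: "'k \<Rightarrow> 'k set" and l :: "'l rel" +
  fixes lo hi :: "'k \<Rightarrow> 'k"
  assumes l_card: "Card_order l"
    and l_inf: "infinite (Field l)"
    and l_le_m: "l \<le>o m"
    and subsets_small: "|X :: 'k set| \<le>o m \<Longrightarrow> |{Q. Q \<subseteq> X \<and> |Q| \<le>o l}| \<le>o m"
    and code: "bij_betw (\<lambda>x. (lo x, hi x)) K (K \<times> K)"
begin

lemma lo_in: "x \<in> K \<Longrightarrow> lo x \<in> K" and hi_in: "x \<in> K \<Longrightarrow> hi x \<in> K"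
  using bij_betwE[OF code] by auto

lemma code_inj: "x \<in> K \<Longrightarrow> y \<in> K \<Longrightarrow> lo x = lo y \<Longrightarrow> hi x = hi y \<Longrightarrow> x = y"
  using bij_betw_imp_inj_on[OF code] by (auto simp: inj_on_def)

lemma code_surj: "a \<in> K \<Longrightarrow> b \<in> K \<Longrightarrow> \<exists>x\<in>K. lo x = a \<and> hi x = b"
  using bij_betw_imp_surj_on[OF code] by (force simp: image_iff set_eq_iff)

text \<open>Positive sets are those meeting a stationary set of values of \<open>lo\<close>, each with unboundedly
  many values of \<open>hi\<close>; closure under a function plays the role of a club.\<close>

definition far :: "('k \<Rightarrow> 'k) \<Rightarrow> 'k \<Rightarrow> bool" where
  "far f t \<longleftrightarrow> t \<in> K \<and> lo t \<in> S \<and> (\<forall>x. x \<sqsubset> lo t \<longrightarrow> f x \<sqsubset> lo t) \<and> f (lo t) \<sqsubset> hi t"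

definition pos :: "'k set \<Rightarrow> bool" where
  "pos X \<longleftrightarrow> (\<forall>f. (\<forall>x\<in>K. f x \<in> K) \<longrightarrow> (\<exists>t\<in>X. far f t))"

lemma posI: "(\<And>f. (\<And>x. x \<in> K \<Longrightarrow> f x \<in> K) \<Longrightarrow> \<exists>t\<in>X. far f t) \<Longrightarrow> pos X"
  by (auto simp: pos_def)

lemma posD: "pos X \<Longrightarrow> (\<And>x. x \<in> K \<Longrightarrow> f x \<in> K) \<Longrightarrow> \<exists>t\<in>X. far f t"
  by (auto simp: pos_def)

lemma not_posE:
  assumes "\<not> pos X"
  obtains f where "\<And>x. x \<in> K \<Longrightarrow> f x \<in> K" "\<And>t. t \<in> X \<Longrightarrow> \<not> far f t"
  using assms by (auto simp: pos_def)

section \<open>The non-positive sets as a normal ideal\<close>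

lemma pos_mono: "pos X \<Longrightarrow> X \<subseteq> Y \<Longrightarrow> pos Y"
  by (auto simp: pos_def) blast

lemma pos_K: "pos K"
proof (rule posI)
  fix f assume f: "\<And>x. x \<in> K \<Longrightarrow> f x \<in> K"
  obtain d where d: "d \<in> S" "\<forall>x. x \<sqsubset> d \<longrightarrow> f x \<sqsubset> d"
    using S_closed[of f] f by blast
  have "d \<in> K" using d S_in by auto
  obtain g where g: "f d \<sqsubset> g"
    using bounded[of "{f d}"] f[OF \<open>d \<in> K\<close>] finite_small[of "{f d}"] by auto
  then obtain t where "t \<in> K" "lo t = d" "hi t = g"
    using code_surj[OF \<open>d \<in> K\<close>, of g] lt_in by blast
  then show "\<exists>t\<in>K. far f t" using d g by (auto simp: far_def)
qed

lemma pos_diff: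
  assumes X: "pos X" and Y: "\<not> pos Y"
  shows "pos (X - Y)"
proof (rule posI)
  fix f assume f: "\<And>x. x \<in> K \<Longrightarrow> f x \<in> K"
  obtain g where g: "\<And>x. x \<in> K \<Longrightarrow> g x \<in> K" "\<And>t. t \<in> Y \<Longrightarrow> \<not> far g t"
    using Y not_posE by blast
  define F where "F x = ub {f x, g x}" for x
  have F: "F x \<in> K" "f x \<sqsubset> F x" "g x \<sqsubset> F x" if "x \<in> K" for x
    using ub[of "{f x, g x}"] f[OF that] g(1)[OF that] finite_small[of "{f x, g x}"]
    by (auto simp: F_def)
  obtain t where t: "t \<in> X" "far F t"
    using posD[OF X, of F] F by blast
  then have "far f t" "far g t"
    using F lt_in[of _ "lo t"] lo_in[of t] trans unfolding far_def by meson+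
  then show "\<exists>t\<in>X - Y. far f t" using t g by blast
qed

text \<open>At most \<open>m\<close> test functions have a pointwise strict bound, and a point far
  for the bound is far for each of them.\<close>

lemma pos_UN:
  assumes J: "|J| \<le>o m" and X: "pos (\<Union>j\<in>J. X j)"
  shows "\<exists>j\<in>J. pos (X j)"
proof (rule ccontr)
  assume "\<not> ?thesis"
  then have "\<forall>j\<in>J. \<exists>f. (\<forall>x\<in>K. f x \<in> K) \<and> (\<forall>t\<in>X j. \<not> far f t)"
    by (auto simp: pos_def)
  then obtain f where f: "\<And>j x. j \<in> J \<Longrightarrow> x \<in> K \<Longrightarrow> f j x \<in> K" "\<And>j t. j \<in> J \<Longrightarrow> t \<in> X j \<Longrightarrow> \<not> far (f j) t"
    by metis
  define F where "F x = ub ((\<lambda>j. f j x) ` J)" for x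
  have F: "F x \<in> K" "j \<in> J \<Longrightarrow> f j x \<sqsubset> F x" if "x \<in> K" for x j
    using ub[of "(\<lambda>j. f j x) ` J"] f(1)[OF _ that] image_small[OF J] by (auto simp: F_def)
  obtain t j where t: "j \<in> J" "t \<in> X j" "far F t"
    using posD[OF X, of F] F by blast
  then have "far (f j) t"
    using F lt_in[of _ "lo t"] lo_in[of t] trans unfolding far_def by meson
  then show False using f t by blast
qed

text \<open>Closure of the ideal under diagonal unions, in place of pressing down.
  \<open>F z\<close> dominates, at all arguments up to \<open>z\<close>, the test functions of all
  sets allotted to some \<open>x\<close> up to \<open>z\<close>; hence a point far for
  \<open>F\<close> is far for every function allotted below its \<open>lo\<close>.\<close>

lemma normal:
  assumes X: "pos X" and D: "\<And>x. x \<in> K \<Longrightarrow> |D x| \<le>o m"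
    and N: "\<And>x j. x \<in> K \<Longrightarrow> j \<in> D x \<Longrightarrow> \<not> pos (N j)"
  shows "pos (X - {t. \<exists>x j. x \<sqsubset> lo t \<and> j \<in> D x \<and> t \<in> N j})"
proof (rule pos_diff[OF X], rule notI)
  assume pos: "pos {t. \<exists>x j. x \<sqsubset> lo t \<and> j \<in> D x \<and> t \<in> N j}"
  \<comment> \<open>The default \<open>id\<close> for positive \<open>N j\<close> only makes the
    choice of \<open>f\<close> total.\<close>
  have "\<forall>j. \<exists>f. (\<forall>x\<in>K. f x \<in> K) \<and> (\<not> pos (N j) \<longrightarrow> (\<forall>t\<in>N j. \<not> far f t))"
  proof
    fix j
    show "\<exists>f. (\<forall>x\<in>K. f x \<in> K) \<and> (\<not> pos (N j) \<longrightarrow> (\<forall>t\<in>N j. \<not> far f t))"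
      by (cases "pos (N j)") (auto intro: exI[of _ id] elim!: not_posE)
  qed
  then obtain f where f: "\<And>j x. x \<in> K \<Longrightarrow> f j x \<in> K"
      "\<And>j t. \<not> pos (N j) \<Longrightarrow> t \<in> N j \<Longrightarrow> \<not> far (f j) t"
    by metis
  define V where "V z = (\<Union>x\<in>{x. x \<sqsubseteq> z}. \<Union>y\<in>{y. y \<sqsubseteq> z}. (\<lambda>j. f j y) ` D x)" for z
  define F where "F z = ub (V z)" for z
  have F: "F z \<in> K" "v \<in> V z \<Longrightarrow> v \<sqsubset> F z" if "z \<in> K" for z v
  proof -
    have "|V z| \<le>o m"
      unfolding V_def
      by (intro UN_small down_small image_small D) (use that lt_in in auto)
    moreover have "V z \<subseteq> K"
      using f(1) lt_in that by (auto simp: V_def)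
    ultimately show "F z \<in> K" "v \<in> V z \<Longrightarrow> v \<sqsubset> F z"
      using ub by (auto simp: F_def)
  qed
  have Ff: "f j y \<sqsubset> F z" if "x \<sqsubseteq> z" "y \<sqsubseteq> z" "j \<in> D x" "z \<in> K" for x y z j
    by (rule F(2)[OF that(4)]) (use that in \<open>auto simp: V_def\<close>)
  obtain t x j where t: "x \<sqsubset> lo t" "j \<in> D x" "t \<in> N j" "far F t"
    using posD[OF pos, of F] F by blast
  have loK: "lo t \<in> K" using t lt_in by blast
  have "far (f j) t"
    unfolding far_def
  proof (intro conjI allI impI)
    fix y assume y: "y \<sqsubset> lo t"
    obtain z where z: "z \<in> {x, y}" "x \<sqsubseteq> z" "y \<sqsubseteq> z"
      using max_le[of x y] t y lt_in by blast
    then have "z \<in> K" "z \<sqsubset> lo t" using t y lt_in by auto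
    then show "f j y \<sqsubset> lo t"
      using Ff[OF z(2,3) t(2)] t(4) trans unfolding far_def by blast
  next
    show "f j (lo t) \<sqsubset> hi t"
      using Ff[of x "lo t" "lo t" j] loK t trans unfolding far_def by blast
  qed (use t in \<open>auto simp: far_def\<close>)
  then show False using f N t lt_in by blast
qed

lemma pos_far:
  assumes X: "pos X" and f: "\<And>x. x \<in> K \<Longrightarrow> f x \<in> K"
  shows "pos {t\<in>X. far f t}"
proof -
  have "\<not> pos (X - {t\<in>X. far f t})"
    using f by (auto simp: pos_def)
  from pos_diff[OF X this] show ?thesis
    by (rule pos_mono) auto
qed

lemma pos_above:
  assumes X: "pos X" and b: "b \<in> K"
  shows "pos {t\<in>X. lo t \<in> S \<and> b \<sqsubset> lo t}"
proof (rule pos_mono)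
  show "pos {t\<in>X. far (\<lambda>_. b) t}" by (rule pos_far[OF X b])
  \<comment> \<open>Closure under a constant function says something only if \<open>lo t\<close> has
    a predecessor; \<open>S_cof\<close> for the empty set supplies one.\<close>
  have "b \<sqsubset> lo t" if "far (\<lambda>_. b) t" for t
    using S_cof[of "lo t" "{}"] card_of_empty1[of l] that l_card
    by (auto simp: far_def card_order_on_well_order_on)
  then show "{t\<in>X. far (\<lambda>_. b) t} \<subseteq> {t\<in>X. lo t \<in> S \<and> b \<sqsubset> lo t}"
    by (auto simp: far_def)
qed

section \<open>Vertices whose ladders jump over an interval\<close>

definition gap :: "'k \<Rightarrow> 'k \<Rightarrow> 'k set" where
  "gap e n = {t\<in>K. lo t \<in> S \<and> n \<sqsubset> lo t \<and> (\<forall>z\<in>A (lo t). e \<sqsubseteq> z \<longrightarrow> \<not> z \<sqsubset> n)}"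

text \<open>Suppose every \<open>e\<close> fails at some \<open>h e\<close>, and let
  \<open>d\<close> in \<open>S\<close> be closed under \<open>h\<close>. A ladder with top beyond
  \<open>d\<close> is bounded below \<open>d\<close> by some \<open>x\<close>, so it misses the
  interval from \<open>x\<close> to \<open>h x\<close>. Its vertex is then in a failing set, yet
  positively many vertices avoid all failing sets with \<open>e\<close> below
  \<open>d\<close>.\<close>

lemma flexible:
  assumes X: "pos X" "X \<subseteq> K"
  shows "\<exists>e\<in>K. \<forall>n\<in>K. pos (X \<inter> gap e n)"
proof (rule ccontr)
  assume "\<not> ?thesis"
  then obtain h where h: "\<And>e. e \<in> K \<Longrightarrow> h e \<in> K" "\<And>e. e \<in> K \<Longrightarrow> \<not> pos (X \<inter> gap e (h e))"
    by metis
  obtain d where d: "d \<in> S" "\<And>x. x \<sqsubset> d \<Longrightarrow> h x \<sqsubset> d"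
    using S_closed[of h] h by blast
  have "\<not> pos (\<Union>e\<in>{e. e \<sqsubset> d}. X \<inter> gap e (h e))"
    using pos_UN[OF segment] h lt_in by blast
  then have "pos (X - (\<Union>e\<in>{e. e \<sqsubset> d}. X \<inter> gap e (h e)))" (is "pos ?Y")
    using pos_diff X by blast
  from pos_above[OF this, of d] obtain t where t: "t \<in> ?Y" "lo t \<in> S" "d \<sqsubset> lo t"
    using d S_in posD[of _ id] by fastforce
  obtain x where x: "x \<sqsubset> d" "\<And>z. z \<in> A (lo t) \<Longrightarrow> z \<sqsubset> d \<Longrightarrow> z \<sqsubset> x"
    using ladder_bounded[OF t(2) d(1) t(3)] by blast
  have "t \<notin> gap x (h x)" using t x by blast
  moreover have "t \<in> K" "h x \<sqsubset> lo t"
    using t X d(2)[OF x(1)] trans[OF _ t(3)] by auto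
  ultimately obtain z where z: "z \<in> A (lo t)" "x \<sqsubseteq> z" "z \<sqsubset> h x"
    using t(2) unfolding gap_def by blast
  have "z \<sqsubset> x" using x(2)[OF z(1)] trans[OF z(3) d(2)[OF x(1)]] by blast
  then show False using z(2) irrefl trans[of z x z] by blast
qed

end

subsection \<open>The graph and a good colour\<close>

context laddered_order
begin

definition adj :: "'k \<Rightarrow> 'k \<Rightarrow> bool" where
  "adj x t \<longleftrightarrow> x \<in> K \<and> t \<in> K \<and> lo t \<in> S \<and> hi x \<sqsubset> lo t \<and> (\<exists>z\<in>A (lo t). lo x \<sqsubseteq> z \<and> z \<sqsubset> hi x)"

lemma adj_in: "adj x t \<Longrightarrow> x \<in> K \<and> t \<in> K"
  by (auto simp: adj_def)

lemma adj_lo_hi: "adj x t \<Longrightarrow> lo x \<sqsubset> hi x"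
  using trans by (auto simp: adj_def)

text \<open>Constraints are sets named by elements of \<open>K\<close> through \<open>e\<close>. A
  family of at most \<lambda> constraints thus becomes a bounded subset of \<open>K\<close>, and
  such families can be counted and diagonalised over.\<close>

definition meet :: "('k \<Rightarrow> 'k set) \<Rightarrow> 'k set \<Rightarrow> 'k set" where
  "meet e Q = {t\<in>K. \<forall>q\<in>Q. t \<in> e q}"

definition below :: "'k \<Rightarrow> 'k set set" where
  "below b = {Q. Q \<subseteq> {x. x \<sqsubseteq> b} \<and> |Q| \<le>o l}"

lemma below_small: "|below b| \<le>o m"
  unfolding below_def by (rule subsets_small[OF down_small])

lemma below_mono: "Q \<in> below b \<Longrightarrow> b \<sqsubset> b' \<Longrightarrow> Q \<in> below b'"
  using trans by (auto simp: below_def)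

lemma l_small: "|X| \<le>o l \<Longrightarrow> |X| \<le>o m"
  using l_le_m ordLeq_transitive by blast

lemma ex_below:
  assumes "Q \<subseteq> K" "|Q| \<le>o l"
  shows "\<exists>b\<in>K. Q \<in> below b"
  using bounded[OF assms(1) l_small[OF assms(2)]] assms(2) by (auto simp: below_def)

text \<open>Otherwise a function bounding \<open>hi\<close> on each column of \<open>X\<close> would
  have no far point in \<open>X\<close>.\<close>

lemma pos_column:
  assumes X: "pos X" "X \<subseteq> K"
  shows "\<exists>a\<in>K. \<forall>b\<in>K. \<exists>x\<in>X. lo x = a \<and> b \<sqsubset> hi x"
proof (rule ccontr)
  assume "\<not> ?thesis"
  then obtain f where f: "\<And>a. a \<in> K \<Longrightarrow> f a \<in> K" "\<And>x. x \<in> X \<Longrightarrow> lo x \<in> K \<Longrightarrow> \<not> f (lo x) \<sqsubset> hi x"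
    by metis
  obtain t where "t \<in> X" "far f t" using posD[OF X(1), of f] f(1) by blast
  then show False using f(2) lo_in by (auto simp: far_def)
qed

text \<open>If every colour were bad for a typical \<open>t\<close>, witnessed by \<open>Q\<^sub>a\<close>, then the union of the
  \<open>Q\<^sub>a\<close> would still be bounded below \<open>lo t\<close>, since \<open>lo t\<close> has large cofinality; its meet is
  positive, so it contains a neighbour of \<open>t\<close> below \<open>lo t\<close>, whose colour is not bad.\<close>

lemma good_colour:
  fixes col :: "'k \<Rightarrow> 'k \<Rightarrow> 'l"
  assumes col: "\<And>x t. adj x t \<Longrightarrow> col x t \<in> Field l"
  shows "\<exists>a\<in>Field l. \<exists>W\<subseteq>K. pos W \<and>
    (\<forall>Q\<subseteq>K. |Q| \<le>o l \<longrightarrow> pos (meet e Q \<inter> W) \<longrightarrow>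
      (\<exists>x\<in>meet e Q. pos {t \<in> meet e Q \<inter> W. adj x t \<and> col x t = a}))"
proof -
  have meetK: "meet e Q \<subseteq> K" for Q by (auto simp: meet_def)
  have "\<forall>Q. \<exists>a. pos (meet e Q) \<longrightarrow> (a \<in> K \<and> (\<forall>b\<in>K. \<exists>x\<in>meet e Q. lo x = a \<and> b \<sqsubset> hi x))"
    using pos_column[OF _ meetK] by blast
  \<comment> \<open>\<open>\<alpha> Q\<close> is a column in which the meet is unbounded;
    \<open>\<xi> Q b\<close> will be a member of that column with \<open>hi\<close> beyond
    \<open>b\<close>.\<close>
  then obtain \<alpha> where \<alpha>: "\<And>Q. pos (meet e Q) \<Longrightarrow> \<alpha> Q \<in> K"
      "\<And>Q b. pos (meet e Q) \<Longrightarrow> b \<in> K \<Longrightarrow> \<exists>x\<in>meet e Q. lo x = \<alpha> Q \<and> b \<sqsubset> hi x"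
    by metis
  then have "\<forall>Q b. \<exists>x. pos (meet e Q) \<longrightarrow> b \<in> K \<longrightarrow> x \<in> meet e Q \<and> lo x = \<alpha> Q \<and> b \<sqsubset> hi x"
    by blast
  then obtain \<xi> where \<xi>: "\<And>Q b. pos (meet e Q) \<Longrightarrow> b \<in> K \<Longrightarrow> \<xi> Q b \<in> meet e Q \<and> lo (\<xi> Q b) = \<alpha> Q \<and> b \<sqsubset> hi (\<xi> Q b)"
    by metis
  define P where "P b = {Q\<in>below b. pos (meet e Q)}" for b
  \<comment> \<open>\<open>F\<close> closes off these choices: if \<open>t\<close> is far for
    \<open>F\<close>, then \<open>\<xi> Q b\<close> with \<open>b\<close> and a bound of
    \<open>Q\<close> below \<open>lo t\<close> has both coordinates below
    \<open>lo t\<close>.\<close>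
  define V where "V z = (\<Union>Q\<in>P z. insert (\<alpha> Q) ((\<lambda>b. hi (\<xi> Q b)) ` {b. b \<sqsubseteq> z}))" for z
  define F where "F z = ub (V z)" for z
  have F: "F z \<in> K" "v \<in> V z \<Longrightarrow> v \<sqsubset> F z" if "z \<in> K" for z v
  proof -
    have "|insert (\<alpha> Q) ((\<lambda>b. hi (\<xi> Q b)) ` {b. b \<sqsubseteq> z})| \<le>o m" for Q
    proof -
      have "|\<Union>X\<in>{{\<alpha> Q}, (\<lambda>b. hi (\<xi> Q b)) ` {b. b \<sqsubseteq> z}}. X| \<le>o m"
        by (rule UN_small) (auto intro: finite_small image_small down_small)
      then show ?thesis by simp
    qed
    then have "|V z| \<le>o m"
      unfolding V_def P_def
      by (intro UN_small subset_small[OF below_small]) auto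
    moreover have "V z \<subseteq> K"
      using \<alpha>(1) \<xi> hi_in lt_in that unfolding V_def P_def meet_def by auto
    ultimately show "F z \<in> K" "v \<in> V z \<Longrightarrow> v \<sqsubset> F z"
      using ub by (auto simp: F_def)
  qed
  \<comment> \<open>The typical points: far for \<open>F\<close> and in no non-positive meet named
    below \<open>lo t\<close>. Normality makes them a positive set.\<close>
  define W0 where "W0 = {t\<in>K. far F t \<and> (\<forall>b Q. b \<sqsubset> lo t \<longrightarrow> Q \<in> below b \<longrightarrow> t \<in> meet e Q \<longrightarrow> pos (meet e Q))}"
  have posW0: "pos W0"
  proof (rule pos_mono)
    let ?N = "\<lambda>Q. if pos (meet e Q) then {} else meet e Q"
    have "\<not> pos {}" by (auto simp: pos_def intro: exI[of _ id])
    then have "\<not> pos (?N Q)" for Q by auto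
    then show "pos ({t\<in>K. far F t} - {t. \<exists>b Q. b \<sqsubset> lo t \<and> Q \<in> below b \<and> t \<in> ?N Q})"
      by (intro normal pos_far pos_K F below_small) auto
    show "\<dots> \<subseteq> W0" unfolding W0_def by auto
  qed
  define good where "good t a \<longleftrightarrow> (\<forall>b Q. b \<sqsubset> lo t \<longrightarrow> Q \<in> below b \<longrightarrow> t \<in> meet e Q \<longrightarrow>
    (\<exists>x\<in>meet e Q. adj x t \<and> col x t = a))" for t a
  have ex_good: "\<exists>a\<in>Field l. good t a" if t: "t \<in> W0" for t
  proof (rule ccontr)
    assume "\<not> ?thesis"
    then have "\<forall>a\<in>Field l. \<exists>b Q. b \<sqsubset> lo t \<and> Q \<in> below b \<and> t \<in> meet e Q \<and>
      (\<forall>x\<in>meet e Q. adj x t \<longrightarrow> col x t \<noteq> a)" unfolding good_def by blast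
    then obtain b Q where bQ: "\<And>a. a \<in> Field l \<Longrightarrow> b a \<sqsubset> lo t" "\<And>a. a \<in> Field l \<Longrightarrow> Q a \<in> below (b a)"
      "\<And>a. a \<in> Field l \<Longrightarrow> t \<in> meet e (Q a)"
      "\<And>a x. a \<in> Field l \<Longrightarrow> x \<in> meet e (Q a) \<Longrightarrow> adj x t \<Longrightarrow> col x t \<noteq> a" by metis
    have tS: "lo t \<in> S" "t \<in> K" using t by (auto simp: W0_def far_def)
    have lF: "|Field l| \<le>o l" using card_of_Field_ordIso[OF l_card] ordIso_imp_ordLeq by blast
    then have "|b ` Field l| \<le>o l" using card_of_image ordLeq_transitive by blast
    then obtain c where c: "c \<sqsubset> lo t" "\<And>a. a \<in> Field l \<Longrightarrow> b a \<sqsubset> c"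
      using S_cof[OF tS(1), of "b ` Field l"] bQ(1) by blast
    have below_c: "Q a \<in> below c" if "a \<in> Field l" for a
      using below_mono bQ(2) c(2) that by blast
    have "|\<Union>a\<in>Field l. Q a| \<le>o l"
      using card_of_UNION_ordLeq_infinite_Field[OF l_inf l_card lF] below_c
      by (auto simp: below_def)
    then have U: "(\<Union>a\<in>Field l. Q a) \<in> below c" (is "?U \<in> _")
      using below_c by (auto simp: below_def)
    have "t \<in> meet e ?U" using bQ(3) tS by (auto simp: meet_def)
    then have posU: "pos (meet e ?U)" using t U c(1) unfolding W0_def by blast
    have cK: "c \<in> K" using c lt_in by blast
    have Ft: "F z \<sqsubset> lo t" if "z \<sqsubset> lo t" for z using t that by (auto simp: W0_def far_def)
    have "\<alpha> ?U \<in> V c" using U posU by (auto simp: V_def P_def)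
    then have "\<alpha> ?U \<sqsubset> lo t" using trans[OF F(2)[OF cK] Ft[OF c(1)]] by blast
    \<comment> \<open>A rung \<open>z\<close> at or above the column lies in the interval of
      \<open>\<xi> ?U z\<close>. Closure under \<open>F\<close> keeps the upper end of that interval
      below \<open>lo t\<close>, so this vertex is adjacent to \<open>t\<close>.\<close>
    then obtain z where z: "z \<in> A (lo t)" "\<alpha> ?U \<sqsubseteq> z" using ladder_unbounded[OF tS(1)] by blast
    have zt: "z \<sqsubset> lo t" using ladder_lt[OF tS(1) z(1)] .
    then have zK: "z \<in> K" using lt_in by blast
    have x: "\<xi> ?U z \<in> meet e ?U" "lo (\<xi> ?U z) = \<alpha> ?U" "z \<sqsubset> hi (\<xi> ?U z)"
      using \<xi>[OF posU zK] by auto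
    obtain y where y: "y \<in> {c, z}" "c \<sqsubseteq> y" "z \<sqsubseteq> y" using max_le[OF cK zK] by blast
    have yK: "y \<in> K" "y \<sqsubset> lo t" using y zK cK zt c(1) by auto
    have "?U \<in> below y" using U y(2) below_mono by blast
    then have "hi (\<xi> ?U z) \<in> V y" using posU y(3) by (auto simp: V_def P_def)
    then have "hi (\<xi> ?U z) \<sqsubset> lo t" using trans[OF F(2)[OF yK(1)] Ft[OF yK(2)]] by blast
    then have adj: "adj (\<xi> ?U z) t" using x z tS by (auto simp: adj_def meet_def)
    have "\<xi> ?U z \<in> meet e (Q (col (\<xi> ?U z) t))" using x(1) col[OF adj] by (auto simp: meet_def)
    then show False using bQ(4)[OF col[OF adj] _ adj] by blast
  qed
  \<comment> \<open>There are at most \<open>m\<close> colours, so by completeness a single one is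
    good on a positive set.\<close>
  have "W0 \<subseteq> (\<Union>a\<in>Field l. {t\<in>W0. good t a})" using ex_good by blast
  then have "pos (\<Union>a\<in>Field l. {t\<in>W0. good t a})" using pos_mono posW0 by blast
  moreover have "|Field l| \<le>o m"
    using card_of_Field_ordIso[OF l_card] ordIso_imp_ordLeq l_small by blast
  ultimately obtain a where a: "a \<in> Field l" "pos {t\<in>W0. good t a}"
    using pos_UN by blast
  define W where "W = {t\<in>W0. good t a}"
  have main: "\<exists>x\<in>meet e Q. pos {t \<in> meet e Q \<inter> W. adj x t \<and> col x t = a}"
    if Q: "Q \<subseteq> K" "|Q| \<le>o l" and X: "pos (meet e Q \<inter> W)" for Q
  proof (rule ccontr)
    assume neg: "\<not> ?thesis"
    define N where "N x = {t \<in> meet e Q \<inter> W. adj x t \<and> col x t = a}" for x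
    \<comment> \<open>A neighbour \<open>x\<close> of \<open>t\<close> has \<open>lo x\<close> below
      \<open>hi x\<close>, so it belongs to \<open>D (hi x)\<close>, and \<open>hi x\<close> is
      below \<open>lo t\<close>. Removing the diagonal union over \<open>D\<close> therefore removes
      every \<open>t\<close> with an \<open>a\<close>-coloured neighbour in the meet.\<close>
    define D where "D b = {x\<in>meet e Q. lo x \<sqsubseteq> b \<and> hi x \<sqsubseteq> b}" for b
    have D_small: "|D b| \<le>o m" for b
    proof -
      have "inj_on (\<lambda>x. (lo x, hi x)) (D b)" "(\<lambda>x. (lo x, hi x)) ` D b \<subseteq> {x. x \<sqsubseteq> b} \<times> {x. x \<sqsubseteq> b}"
        using code_inj by (auto simp: D_def meet_def intro!: inj_onI)
      then have "|D b| \<le>o |{x. x \<sqsubseteq> b} \<times> {x. x \<sqsubseteq> b}|"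
        using card_of_ordLeq by blast
      also have "|{x. x \<sqsubseteq> b} \<times> {x. x \<sqsubseteq> b}| \<le>o m"
        using card_of_Times_ordLeq_infinite_Field[OF m_inf down_small down_small m_card] .
      finally show ?thesis .
    qed
    have N: "\<not> pos (N x)" if "x \<in> D b" for x b using neg that by (auto simp: N_def D_def)
    obtain b where b: "b \<in> K" "Q \<in> below b" using ex_below[OF Q] by blast
    have "pos (meet e Q \<inter> W - {t. \<exists>x j. x \<sqsubset> lo t \<and> j \<in> D x \<and> t \<in> N j})"
      by (rule normal[OF X D_small N])
    from posD[OF pos_above[OF this b(1)], of id] obtain t where
      t: "t \<in> meet e Q" "t \<in> W" "b \<sqsubset> lo t" "\<And>x j. x \<sqsubset> lo t \<Longrightarrow> j \<in> D x \<Longrightarrow> t \<notin> N j"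
      by auto
    obtain x where x: "x \<in> meet e Q" "adj x t" "col x t = a"
      using t b(2) unfolding W_def good_def by blast
    have "x \<in> D (hi x)" using x adj_lo_hi by (auto simp: D_def)
    moreover have "hi x \<sqsubset> lo t" using x by (auto simp: adj_def)
    ultimately show False using t x by (auto simp: N_def)
  qed
  have "W \<subseteq> K" "pos W" using a(2) by (auto simp: W_def W0_def)
  then show ?thesis using a(1) main by blast
qed

end

subsection \<open>The monochromatic tree\<close>

context laddered_order
begin

text \<open>Lays out a tree of stages inside \<open>K\<close> with \<open>lo\<close> as the parent
  map. The coordinate \<open>lo (hi y)\<close> records the child number, while the free coordinate
  \<open>hi (hi y)\<close> gives too many candidates for all of them to lie in the segment up to
  \<open>x\<close>.\<close>

lemma child_function:
  shows "\<exists>ch. \<forall>x\<in>K. inj_on (ch x) K \<and> (\<forall>i\<in>K. ch x i \<in> K \<and> x \<sqsubset> ch x i \<and> lo (ch x i) = x)"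
proof -
  have ex: "\<exists>y\<in>K. x \<sqsubset> y \<and> lo y = x \<and> lo (hi y) = i" if xi: "x \<in> K" "i \<in> K" for x i
  proof (rule ccontr)
    assume neg: "\<not> ?thesis"
    have "\<forall>j\<in>K. \<exists>y. y \<in> K \<and> lo y = x \<and> lo (hi y) = i \<and> hi (hi y) = j"
    proof
      fix j assume "j \<in> K"
      then obtain w where "w \<in> K" "lo w = i" "hi w = j" using code_surj xi by blast
      moreover then obtain y where "y \<in> K" "lo y = x" "hi y = w" using code_surj xi by blast
      ultimately show "\<exists>y. y \<in> K \<and> lo y = x \<and> lo (hi y) = i \<and> hi (hi y) = j" by blast
    qed
    then have "K \<subseteq> (\<lambda>y. hi (hi y)) ` {y. y \<sqsubseteq> x}"
      using neg not_lt[OF xi(1)] by (fastforce simp: image_iff)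
    then have "|K| \<le>o m" using subset_small image_small down_small by meson
    then obtain b where "b \<in> K" "\<forall>x\<in>K. x \<sqsubset> b" using bounded[of K] by blast
    then show False using irrefl by blast
  qed
  define ch where "ch x i = (SOME y. y \<in> K \<and> x \<sqsubset> y \<and> lo y = x \<and> lo (hi y) = i)" for x i
  have ch: "ch x i \<in> K \<and> x \<sqsubset> ch x i \<and> lo (ch x i) = x \<and> lo (hi (ch x i)) = i"
    if "x \<in> K" "i \<in> K" for x i
    unfolding ch_def using ex[OF that] by (intro someI_ex[of "\<lambda>y. _ y \<and> _ y"]) blast
  have "inj_on (ch x) K" if "x \<in> K" for x
    by (rule inj_on_inverseI[of _ "\<lambda>y. lo (hi y)"]) (use ch that in blast)
  then show ?thesis using ch by blast
qed

text \<open>A stage of the construction is a triple \<open>(x, Q, e)\<close>: the vertex chosen, the constraints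
  imposed on all its descendants, and a bound above which the ladders of the latter may start
  arbitrarily late.\<close>

definition stage :: "('k \<Rightarrow> 'k set) \<Rightarrow> 'k set \<Rightarrow> 'k \<times> 'k set \<times> 'k \<Rightarrow> bool" where
  "stage E W = (\<lambda>(x, Q, e). x \<in> K \<and> Q \<subseteq> K \<and> finite Q \<and> e \<in> K \<and> (\<forall>n\<in>K. pos (meet E Q \<inter> W \<inter> gap e n)))"

text \<open>\<open>n\<close> is meant to bound everything used so far: the new vertex and all its
  descendants have ladders that avoid the interval from \<open>e0\<close> to
  \<open>n\<close>.\<close>

definition step :: "('k \<Rightarrow> 'k set) \<Rightarrow> 'k set \<Rightarrow> ('k \<Rightarrow> 'k set) \<Rightarrow> 'k \<Rightarrow> 'k \<times> 'k set \<times> 'k \<Rightarrow> 'k \<times> 'k set \<times> 'k \<Rightarrow> bool" where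
  "step E W N n = (\<lambda>(x0, Q0, e0) (x, Q, e). stage E W (x, Q, e) \<and> x \<in> meet E Q0 \<inter> gap e0 n \<and>
     meet E Q \<subseteq> meet E Q0 \<inter> gap e0 n \<inter> N x)"

text \<open>All finite sequences over \<open>K\<close> are embedded, so that every node has the same
  set of successors; the increasing ones are selected at the end.\<close>

lemma tree_copy:
  fixes col :: "'k \<Rightarrow> 'k \<Rightarrow> 'l"
  assumes col: "\<And>x t. adj x t \<Longrightarrow> col x t \<in> Field l" and lK: "l \<le>o |K|"
  shows "\<exists>a\<in>Field l. \<exists>\<phi>. inj_on \<phi> (lists K) \<and> \<phi> ` lists K \<subseteq> K \<and>
    (\<forall>s\<in>lists K. \<forall>t\<in>lists K. (strict_prefix s t \<longrightarrow> adj (\<phi> s) (\<phi> t) \<and> col (\<phi> s) (\<phi> t) = a) \<and>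
      (\<not> prefix s t \<longrightarrow> \<not> prefix t s \<longrightarrow> \<not> adj (\<phi> s) (\<phi> t)))"
proof -
  have K_inf: "infinite K"
  proof
    assume "finite K"
    then obtain b where "b \<in> K" "\<forall>x\<in>K. x \<sqsubset> b" using bounded[of K] finite_small by blast
    then show False using irrefl by blast
  qed
  have "|Field l| \<le>o |K|"
    using card_of_Field_ordIso[OF l_card] ordIso_ordLeq_trans lK by blast
  \<comment> \<open>All constraints that may occur, for every colour at once, because the good
    colour is found only after the enumeration \<open>E\<close> is fixed.\<close>
  define B where "B = (\<lambda>(e, n). gap e n) ` (K \<times> K) \<union> (\<lambda>(a, x). {t. adj x t \<and> col x t = a}) ` (Field l \<times> K)"
  have "|K \<times> K| \<le>o |K|" "|Field l \<times> K| \<le>o |K|"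
    using card_of_Times_ordLeq_infinite_Field[of "|K|"] K_inf \<open>|Field l| \<le>o |K|\<close>
      ordIso_imp_ordLeq[OF card_of_refl] card_of_Card_order by (auto simp: Field_card_of)
  then have "|(\<lambda>(e, n). gap e n) ` (K \<times> K)| \<le>o |K|"
    "|(\<lambda>(a, x). {t. adj x t \<and> col x t = a}) ` (Field l \<times> K)| \<le>o |K|"
    using card_of_image ordLeq_transitive by blast+
  then have "|B| \<le>o |K|"
    using card_of_Un_ordLeq_infinite_Field[of "|K|"] K_inf card_of_Card_order
    unfolding B_def Field_card_of by blast
  moreover have "B \<noteq> {}" using K_inf by (auto simp: B_def)
  ultimately obtain E where E: "E ` K = B" using card_of_ordLeq2 by metis
  obtain a W where aW: "a \<in> Field l" "W \<subseteq> K" "pos W"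
    and good: "\<forall>Q\<subseteq>K. |Q| \<le>o l \<longrightarrow> pos (meet E Q \<inter> W) \<longrightarrow>
      (\<exists>x\<in>meet E Q. pos {t \<in> meet E Q \<inter> W. adj x t \<and> col x t = a})"
    using good_colour[where e = E and col = col, OF col] by blast
  define N where "N x = {t. adj x t \<and> col x t = a}" for x
  have finl: "|Q| \<le>o l" if "finite Q" for Q :: "'k set"
    using finite_ordLess_infinite[OF card_of_Well_order card_order_on_well_order_on[OF l_card] _ l_inf]
      ordLess_imp_ordLeq Field_card_of that by metis
  \<comment> \<open>Impose the gap, let \<open>good\<close> pick a vertex \<open>x\<close> with
    positively many \<open>a\<close>-neighbours, impose being such a neighbour, and obtain a new
    bound \<open>e\<close> from \<open>flexible\<close>.\<close>
  have step_ex: "\<exists>d. step E W N n d0 d" if d0: "stage E W d0" and n: "n \<in> K" for n d0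
  proof -
    obtain x0 Q0 e0 where d0_eq: "d0 = (x0, Q0, e0)" by (cases d0)
    have Q0: "Q0 \<subseteq> K" "finite Q0" "e0 \<in> K" "pos (meet E Q0 \<inter> W \<inter> gap e0 n)"
      using d0 n by (auto simp: stage_def d0_eq)
    have "gap e0 n \<in> B" using Q0 n by (auto simp: B_def)
    then obtain g where g: "g \<in> K" "E g = gap e0 n" using E by (metis imageE)
    have m1: "meet E (insert g Q0) = meet E Q0 \<inter> gap e0 n" using g by (auto simp: meet_def)
    have "meet E Q0 \<inter> W \<inter> gap e0 n = meet E (insert g Q0) \<inter> W" using m1 by auto
    then have "pos (meet E (insert g Q0) \<inter> W)" using Q0(4) by argo
    moreover have "insert g Q0 \<subseteq> K" "|insert g Q0| \<le>o l" using Q0 g finl by auto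
    ultimately obtain x where x: "x \<in> meet E (insert g Q0)"
        "pos {t \<in> meet E (insert g Q0) \<inter> W. adj x t \<and> col x t = a}"
      using good by blast
    have xK: "x \<in> K" using x by (auto simp: meet_def)
    then have "N x \<in> B" using aW(1) by (auto simp: B_def N_def)
    then obtain h where h: "h \<in> K" "E h = N x" using E by (metis imageE)
    define Q where "Q = insert h (insert g Q0)"
    have m2: "meet E Q = meet E Q0 \<inter> gap e0 n \<inter> N x"
      using m1 h by (auto simp: Q_def meet_def)
    have "pos (meet E Q \<inter> W)"
      using x(2) by (rule pos_mono) (auto simp: m1 m2 N_def)
    then obtain e where "e \<in> K" "\<forall>n\<in>K. pos (meet E Q \<inter> W \<inter> gap e n)"
      using flexible[of "meet E Q \<inter> W"] aW(2) by blast
    moreover have "Q \<subseteq> K" "finite Q" using Q0 g h by (auto simp: Q_def)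
    moreover have "x \<in> meet E Q0 \<inter> gap e0 n" using x(1) m1 by simp
    ultimately have "step E W N n d0 (x, Q, e)"
      using xK m2 by (simp add: step_def stage_def d0_eq subset_iff)
    then show ?thesis ..
  qed
  obtain \<rho> where \<rho>: "\<rho> \<in> K" using K_inf by fastforce
  obtain e0 where e0: "e0 \<in> K" "\<forall>n\<in>K. pos (W \<inter> gap e0 n)"
    using flexible[OF aW(3,2)] by blast
  \<comment> \<open>The start carries no constraint; its vertex \<open>\<rho>\<close> is a
    placeholder.\<close>
  define d0 where "d0 = (\<rho>, {}::'k set, e0)"
  have d0: "stage E W d0"
    using e0 \<rho> aW(2) by (auto simp: stage_def d0_def meet_def Int_absorb1)
  \<comment> \<open>The bound runs over all earlier stages, not only the ancestors; this lets
    ladders jump over the intervals of other branches.\<close>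
  define bd where "bd f y = ub (\<Union>z\<in>{z. z \<sqsubset> y}. {lo (fst (f z)), hi (fst (f z)), snd (snd (f z))})"
    for f :: "'k \<Rightarrow> 'k \<times> 'k set \<times> 'k" and y
  \<comment> \<open>A stage is built for every \<open>y\<close> in \<open>K\<close>; if
    \<open>lo y\<close> is not earlier than \<open>y\<close>, it starts from
    \<open>d0\<close>.\<close>
  define par where "par f y = (if lo y \<sqsubset> y then f (lo y) else d0)"
    for f :: "'k \<Rightarrow> 'k \<times> 'k set \<times> 'k" and y
  define R where "R = {(x, y). x \<sqsubset> y}"
  define dat where "dat = wfrec R (\<lambda>f y. SOME d. step E W N (bd f y) (par f y) d)"
  have dat_eq: "dat y = (SOME d. step E W N (bd dat y) (par dat y) d)" for y
  proof -
    have "bd (cut dat R y) y = bd dat y" "par (cut dat R y) y = par dat y"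
      by (auto simp: bd_def par_def cut_def R_def intro!: arg_cong[where f = ub])
    then show ?thesis
      using wfrec[of R "\<lambda>f y. SOME d. step E W N (bd f y) (par f y) d" y] wf_lt
      unfolding dat_def[symmetric] R_def[symmetric] by simp
  qed
  define now where "now y = bd dat y" for y
  have dat: "y \<in> K \<Longrightarrow> step E W N (now y) (par dat y) (dat y) \<and> now y \<in> K \<and>
      (\<forall>z. z \<sqsubset> y \<longrightarrow> lo (fst (dat z)) \<sqsubset> now y \<and> hi (fst (dat z)) \<sqsubset> now y \<and> snd (snd (dat z)) \<sqsubset> now y)" for y
  proof (induction y rule: wf_induct_rule[OF wf_lt])
    case (1 y)
    have IH: "stage E W (dat z)" if "z \<sqsubset> y" for z
      using 1(1)[of z] that lt_in by (auto simp: step_def split: prod.splits)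
    let ?V = "\<Union>z\<in>{z. z \<sqsubset> y}. {lo (fst (dat z)), hi (fst (dat z)), snd (snd (dat z))}"
    have "?V \<subseteq> K" using IH lo_in hi_in by (fastforce simp: stage_def split: prod.splits)
    moreover have "|?V| \<le>o m" by (intro UN_small segment finite_small) auto
    ultimately have V: "now y \<in> K" "\<And>v. v \<in> ?V \<Longrightarrow> v \<sqsubset> now y"
      using ub[of ?V] by (auto simp: now_def bd_def)
    have "stage E W (par dat y)" using IH d0 by (auto simp: par_def)
    then have "step E W N (now y) (par dat y) (dat y)"
      using someI_ex[OF step_ex] V(1) unfolding dat_eq[of y] now_def by blast
    then show ?case using V by auto
  qed
  define v where "v y = fst (dat y)" for y
  define C where "C y = meet E (fst (snd (dat y)))" for y
  define g where "g y = snd (snd (dat y))" for y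
  have now: "now y \<in> K" "z \<sqsubset> y \<Longrightarrow> lo (v z) \<sqsubset> now y \<and> hi (v z) \<sqsubset> now y \<and> g z \<sqsubset> now y"
    if "y \<in> K" for y z using dat[OF that] by (auto simp: v_def g_def)
  have vK: "v y \<in> K" "C y \<subseteq> N (v y)" "now y \<sqsubset> lo (v y)" if "y \<in> K" for y
    using dat[OF that]
    by (auto simp: v_def C_def step_def stage_def gap_def split: prod.splits)
  have vC: "v y \<in> C (lo y) \<inter> gap (g (lo y)) (now y)" "C y \<subseteq> C (lo y) \<inter> gap (g (lo y)) (now y)"
    if "y \<in> K" "lo y \<sqsubset> y" for y
    using dat[OF that(1)] that(2)
    by (auto simp: v_def C_def g_def step_def par_def split: prod.splits)
  obtain ch where ch0: "\<forall>x\<in>K. inj_on (ch x) K \<and> (\<forall>i\<in>K. ch x i \<in> K \<and> x \<sqsubset> ch x i \<and> lo (ch x i) = x)"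
    using child_function by blast
  then have ch: "x \<in> K \<Longrightarrow> i \<in> K \<Longrightarrow> ch x i \<in> K \<and> x \<sqsubset> ch x i \<and> lo (ch x i) = x"
    "x \<in> K \<Longrightarrow> i \<in> K \<Longrightarrow> j \<in> K \<Longrightarrow> ch x i = ch x j \<Longrightarrow> i = j" for x i j
    by (auto dest: inj_onD)
  define node where "node = foldl ch \<rho>"
  have node_Nil: "node [] = \<rho>" and node_snoc: "node (s @ [i]) = ch (node s) i" for s i
    by (auto simp: node_def)
  have node_in: "set s \<subseteq> K \<Longrightarrow> node s \<in> K" for s
    by (induction s rule: rev_induct) (use \<rho> ch(1) in \<open>auto simp: node_Nil node_snoc\<close>)
  have node_root: "set s \<subseteq> K \<Longrightarrow> s \<noteq> [] \<Longrightarrow> \<rho> \<sqsubset> node s" for s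
  proof (induction s rule: rev_induct)
    case (snoc i s)
    then have "node s \<sqsubset> node (s @ [i])" using ch(1) node_in by (simp add: node_snoc)
    then show ?case using snoc trans by (cases "s = []") (auto simp: node_Nil)
  qed simp
  have node_inj: "set s \<subseteq> K \<Longrightarrow> set t \<subseteq> K \<Longrightarrow> node s = node t \<Longrightarrow> s = t" for s t
  proof (induction s arbitrary: t rule: rev_induct)
    case Nil
    then show ?case using node_root[of t] irrefl by (auto simp: node_Nil)
  next
    case (snoc i s)
    then obtain j u where t: "t = u @ [j]"
      using node_root[of "s @ [i]"] irrefl by (cases t rule: rev_cases) (auto simp: node_Nil)
    have in_K: "set s \<subseteq> K" "i \<in> K" "set u \<subseteq> K" "j \<in> K" using snoc.prems t by auto
    have eq: "ch (node s) i = ch (node u) j" using snoc.prems(3) t by (simp add: node_snoc)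
    have "lo (ch (node s) i) = node s" "lo (ch (node u) j) = node u"
      using ch(1) node_in in_K by blast+
    then have su: "node s = node u" using eq by simp
    then have "i = j" using ch(2)[OF node_in in_K(2,4)] in_K(1) eq by simp
    then show ?case using snoc.IH[OF in_K(1,3) su] t by simp
  qed
  have ext: "v (node t) \<in> C (node s) \<and> C (node t) \<subseteq> C (node s) \<and> node s \<sqsubset> node t"
    if "set t \<subseteq> K" "strict_prefix s t" for s t
    using that
  proof (induction t rule: rev_induct)
    case (snoc i t)
    have i: "set t \<subseteq> K" "i \<in> K" using snoc.prems by auto
    have c: "node (t @ [i]) \<in> K" "node t \<sqsubset> node (t @ [i])" "lo (node (t @ [i])) = node t"
      using ch(1)[OF node_in[OF i(1)] i(2)] by (auto simp: node_snoc)
    then have "v (node (t @ [i])) \<in> C (node t)" "C (node (t @ [i])) \<subseteq> C (node t)"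
      using vC[OF c(1)] by auto
    moreover have "s = t \<or> strict_prefix s t"
      using snoc.prems(2) by (auto simp: strict_prefix_def prefix_snoc)
    ultimately show ?case using snoc.IH[OF i(1)] c(2) trans[of "node s" "node t"] by blast
  qed simp
  \<comment> \<open>Indices increase along the branch to \<open>t\<close> and never equal
    \<open>node s\<close>, so one edge of the branch straddles \<open>node s\<close>. At that edge
    the ladders of \<open>t\<close> and its descendants were made to jump.\<close>
  have split: "\<exists>p i. prefix (p @ [i]) t \<and> node p \<sqsubset> node s \<and> node s \<sqsubset> node (p @ [i])"
    if "set s \<subseteq> K" "set t \<subseteq> K" "\<not> prefix s t" "node s \<sqsubset> node t" for s t
    using that
  proof (induction t rule: rev_induct)
    case Nil
    then have "s \<noteq> []" by auto
    then have "\<rho> \<sqsubset> \<rho>"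
      using node_root[OF Nil(1)] Nil(4) trans[of \<rho> "node s" \<rho>] by (simp add: node_Nil)
    then show ?case using irrefl by blast
  next
    case (snoc i t)
    have t: "set t \<subseteq> K" "\<not> prefix s t" using snoc.prems by auto
    then have "node s \<noteq> node t" using node_inj[OF snoc.prems(1)] by auto
    then consider "node s \<sqsubset> node t" | "node t \<sqsubset> node s"
      using total node_in snoc.prems(1) t(1) by blast
    then show ?case
    proof cases
      case 1
      then show ?thesis using snoc.IH[OF snoc.prems(1) t] by (auto simp: prefix_snoc)
    next
      case 2
      then show ?thesis using snoc.prems by blast
    qed
  qed
  have mono: "lo (v x) \<sqsubset> lo (v y)" if "x \<sqsubset> y" for x y
    using now(2)[of y x] vK(3)[of y] that lt_in[OF that] trans[of "lo (v x)" "now y"] by blast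
  have nadj: "\<not> adj (v (node s)) (v (node t)) \<and> \<not> adj (v (node t)) (v (node s))"
    if s: "set s \<subseteq> K" and t: "set t \<subseteq> K" and np: "\<not> prefix s t" and st: "node s \<sqsubset> node t" for s t
  proof -
    obtain p i where p: "prefix (p @ [i]) t" "node p \<sqsubset> node s" "node s \<sqsubset> node (p @ [i])"
      using split[OF s t np st] by blast
    have pK: "set p \<subseteq> K" "i \<in> K" using set_mono_prefix[OF p(1)] t by auto
    have c: "node (p @ [i]) \<in> K" "lo (node (p @ [i])) = node p" "node p \<sqsubset> node (p @ [i])"
      using ch(1)[OF node_in[OF pK(1)] pK(2)] by (auto simp: node_snoc)
    have gap: "v (node t) \<in> gap (g (node p)) (now (node (p @ [i])))"
      using vC[OF c(1)] c(2,3) ext[OF t, of "p @ [i]"] p(1) by (auto simp: strict_prefix_def)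
    \<comment> \<open>The interval of the vertex at \<open>s\<close> lies inside the gap: its lower
      end exceeds the bound fixed earlier at \<open>p\<close>, and its upper end is below the bound
      taken later at the child of \<open>p\<close>.\<close>
    have "g (node p) \<sqsubset> lo (v (node s))"
      using now(2)[OF node_in[OF s] p(2)] vK(3)[OF node_in[OF s]] trans[of _ "now (node s)"] by blast
    moreover have "hi (v (node s)) \<sqsubset> now (node (p @ [i]))"
      using now(2)[OF c(1) p(3)] by blast
    ultimately have "g (node p) \<sqsubseteq> z \<and> z \<sqsubset> now (node (p @ [i]))"
      if z: "lo (v (node s)) \<sqsubseteq> z" "z \<sqsubset> hi (v (node s))" for z
      using z(1) trans[of "g (node p)" "lo (v (node s))" z] trans[OF z(2)] by blast
    then have "\<not> adj (v (node s)) (v (node t))"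
      using gap unfolding adj_def gap_def by blast
    moreover have "\<not> adj (v (node t)) (v (node s))"
    proof
      assume *: "adj (v (node t)) (v (node s))"
      then have "hi (v (node t)) \<sqsubset> lo (v (node s))" unfolding adj_def by blast
      then have "lo (v (node t)) \<sqsubset> lo (v (node s))" by (rule trans[OF adj_lo_hi[OF *]])
      then show False using trans[OF mono[OF st]] irrefl by blast
    qed
    ultimately show ?thesis by blast
  qed
  have "inj_on (\<lambda>s. v (node s)) (lists K)"
  proof (rule inj_onI)
    fix s t assume "s \<in> lists K" "t \<in> lists K" and eq: "v (node s) = v (node t)"
    then have st: "set s \<subseteq> K" "set t \<subseteq> K" by auto
    have "\<not> node s \<sqsubset> node t" "\<not> node t \<sqsubset> node s" using mono eq irrefl by metis+
    then have "node s = node t" using total node_in st by blast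
    then show "s = t" using node_inj st by blast
  qed
  moreover have "(\<lambda>s. v (node s)) ` lists K \<subseteq> K"
    using vK(1) node_in by (auto simp: lists_eq_set)
  moreover have "adj (v (node s)) (v (node t)) \<and> col (v (node s)) (v (node t)) = a"
    if "s \<in> lists K" "t \<in> lists K" "strict_prefix s t" for s t
  proof -
    have "set s \<subseteq> K" "set t \<subseteq> K" using that by auto
    then show ?thesis
      using ext[of t s] that(3) vK(2)[of "node s"] node_in[of s] by (auto simp: N_def)
  qed
  moreover have "\<not> adj (v (node s)) (v (node t))"
    if "s \<in> lists K" "t \<in> lists K" "\<not> prefix s t" "\<not> prefix t s" for s t
  proof -
    have st: "set s \<subseteq> K" "set t \<subseteq> K" using that by auto
    then have "node s \<noteq> node t" using node_inj that(3) by blast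
    then show ?thesis using total node_in st nadj that(3,4) by blast
  qed
  ultimately show ?thesis
    using aW(1) by (intro bexI[of _ a] exI[of _ "\<lambda>s. v (node s)"]) blast+
qed

end

subsection \<open>Ladders of type \<open>\<lambda>\<^sup>+\<close> below \<open>(2\<^sup>\<lambda>)\<^sup>+\<close>\<close>

text \<open>Regularity of infinite successor cardinals; boundedness is \<open>cardSuc_UNION\<close>
  applied to the chain of initial segments.\<close>

lemma cardSuc_regular_order:
  assumes r: "Card_order r" and inf: "infinite (Field r)"
  shows "regular_order (Field (cardSuc r)) (\<lambda>x y. (x, y) \<in> cardSuc r - Id) r"
proof -
  let ?r = "cardSuc r"
  have card: "Card_order ?r" and inf': "infinite (Field ?r)"
    using cardSuc_Card_order[OF r] cardSuc_finite[OF r] inf by auto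
  have wo: "Well_order ?r" using cardSuc_Well_order[OF r] .
  then have *: "trans ?r" "antisym ?r" "Total ?r" "wf (?r - Id)"
    by (auto simp: well_order_on_def linear_order_on_def partial_order_on_def preorder_on_def)
  have tr: "(x, z) \<in> ?r - Id" if "(x, y) \<in> ?r - Id" "(y, z) \<in> ?r - Id" for x y z
    using that *(1,2) by (auto dest: transD antisymD)
  show ?thesis
  proof (unfold_locales)
    show "(x, z) \<in> ?r - Id" if "(x, y) \<in> ?r - Id" "(y, z) \<in> ?r - Id" for x y z
      by (rule tr[OF that])
    show "(x, y) \<in> ?r - Id \<or> x = y \<or> (y, x) \<in> ?r - Id" if "x \<in> Field ?r" "y \<in> Field ?r" for x y
      using *(3) that by (auto simp: total_on_def)
    show "x \<in> Field ?r \<and> y \<in> Field ?r" if "(x, y) \<in> ?r - Id" for x y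
      using that by (auto simp: Field_def)
    show "wf {(x, y). (x, y) \<in> ?r - Id}" using *(4) by (rule wf_subset) auto
    show "\<exists>b\<in>Field ?r. \<forall>x\<in>X. (x, b) \<in> ?r - Id" if X: "X \<subseteq> Field ?r" "|X| \<le>o r" for X
    proof -
      have "X \<subseteq> (\<Union>b\<in>Field ?r. underS ?r b)"
        using infinite_Card_order_limit[OF card inf'] X(1) by (auto simp: underS_def)
      moreover have "relChain ?r (underS ?r)"
        unfolding relChain_def underS_def using *(1,2) by (auto dest: transD antisymD)
      ultimately obtain b where "b \<in> Field ?r" "X \<subseteq> underS ?r b"
        using cardSuc_UNION[OF r inf _ _ X(2)] by blast
      then show ?thesis by (auto simp: underS_def)
    qed
    show "|{x. (x, b) \<in> ?r - Id}| \<le>o r" for b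
    proof (cases "b \<in> Field ?r")
      case True
      have "{x. (x, b) \<in> ?r - Id} = underS ?r b" by (auto simp: underS_def)
      moreover have "|underS ?r b| \<le>o r"
        using card_of_underS[OF card True] cardSuc_ordLeq_ordLess[OF r card_of_Card_order] by blast
      ultimately show ?thesis by argo
    next
      case False
      then have "{x. (x, b) \<in> ?r - Id} = {}" by (auto simp: Field_def)
      then show ?thesis using card_of_empty1 card_order_on_well_order_on[OF r] by metis
    qed
  qed (use r inf in auto)
qed

text \<open>\<open>S\<close> consists of the limits of strictly increasing
  \<open>J\<close>-sequences. Regularity of \<open>J\<close> gives the cofinality property, and this
  bounds the part of a ladder below an earlier \<open>e\<close>, which is indexed by a proper
  segment of \<open>J\<close>.\<close>

lemma ladder_system_exists:
  fixes K :: "'k set" and J :: "'j set" and l :: "'l rel"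
  assumes "regular_order K lt m" and "regular_order J ltJ l" and J: "|J| \<le>o m"
  shows "\<exists>S A. ladder_system K lt m S A l"
proof -
  interpret K: regular_order K lt m by fact
  interpret J: regular_order J ltJ l by fact
  define ladder where "ladder d g \<longleftrightarrow> (\<forall>i\<in>J. lt (g i) d) \<and> (\<forall>i\<in>J. \<forall>j. ltJ j i \<longrightarrow> lt (g j) (g i)) \<and>
    (\<forall>x. lt x d \<longrightarrow> (\<exists>i\<in>J. lt x (g i) \<or> x = g i))" for d g
  define S where "S = {d\<in>K. \<exists>g. ladder d g}"
  define g where "g d = (SOME g. ladder d g)" for d
  have "ladder d (g d)" if "d \<in> S" for d
    using that someI_ex[of "ladder d"] unfolding S_def g_def by blast
  then have lad: "i \<in> J \<Longrightarrow> lt (g d i) d" "i \<in> J \<Longrightarrow> ltJ j i \<Longrightarrow> lt (g d j) (g d i)"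
    "lt x d \<Longrightarrow> \<exists>i\<in>J. lt x (g d i) \<or> x = g d i" if "d \<in> S" for d i j x
    using that unfolding ladder_def by blast+
  have cof: "\<exists>x. lt x d \<and> (\<forall>z\<in>Z. lt z x)" if d: "d \<in> S" and Z: "Z \<subseteq> {x. lt x d}" "|Z| \<le>o l" for d Z
  proof -
    have "\<forall>z\<in>Z. \<exists>i. i \<in> J \<and> (lt z (g d i) \<or> z = g d i)" using lad(3)[OF d] Z by blast
    then obtain i where i: "\<And>z. z \<in> Z \<Longrightarrow> i z \<in> J" "\<And>z. z \<in> Z \<Longrightarrow> lt z (g d (i z)) \<or> z = g d (i z)"
      by metis
    obtain b where b: "b \<in> J" "\<And>z. z \<in> Z \<Longrightarrow> ltJ (i z) b"
      using J.bounded[of "i ` Z"] J.image_small[OF Z(2)] i(1) by blast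
    have "lt z (g d b)" if "z \<in> Z" for z
      by (rule K.le_lt_trans[OF i(2)[OF that] lad(2)[OF d b(1) b(2)[OF that]]])
    then show ?thesis using lad(1)[OF d b(1)] by blast
  qed
  have bdd: "\<exists>x. lt x e \<and> (\<forall>z\<in>g d ` J. lt z e \<longrightarrow> lt z x)" if d: "d \<in> S" and e: "e \<in> S" "lt e d" for d e
  proof -
    obtain i where i: "i \<in> J" "lt e (g d i) \<or> e = g d i" using lad(3)[OF d e(2)] by blast
    have "{z\<in>g d ` J. lt z e} \<subseteq> g d ` {j. ltJ j i}"
    proof
      fix z assume "z \<in> {z\<in>g d ` J. lt z e}"
      then obtain j where j: "j \<in> J" "z = g d j" "lt (g d j) e" by blast
      have "lt (g d j) (g d i)" using j(3) i(2) K.trans by blast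
      then have "\<not> (ltJ i j \<or> i = j)" using lad(2)[OF d j(1), of i] K.irrefl K.trans by blast
      then have "ltJ j i" using J.total[OF i(1) j(1)] by blast
      then show "z \<in> g d ` {j. ltJ j i}" using j(2) by blast
    qed
    then have "|{z\<in>g d ` J. lt z e}| \<le>o l"
      using J.subset_small J.image_small J.segment by meson
    then show ?thesis using cof[OF e(1), of "{z\<in>g d ` J. lt z e}"] by blast
  qed
  have closed: "\<exists>d\<in>S. \<forall>x. lt x d \<longrightarrow> lt (f x) d" if f: "\<And>x. x \<in> K \<Longrightarrow> f x \<in> K" for f
  proof -
    \<comment> \<open>Closure points come from iterating \<open>h\<close> along \<open>J\<close>:
      each iterate exceeds \<open>h\<close> of all earlier ones, and the least strict bound of the
      iterates is closed under \<open>f\<close>.\<close>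
    define h where "h z = K.ub (\<Union>x\<in>{x. lt x z \<or> x = z}. {x, f x})" for z
    have h: "h z \<in> K" "lt x z \<or> x = z \<Longrightarrow> lt x (h z) \<and> lt (f x) (h z)" if "z \<in> K" for x z
    proof -
      have "(\<Union>x\<in>{x. lt x z \<or> x = z}. {x, f x}) \<subseteq> K" using f K.lt_in that by auto
      moreover have "|\<Union>x\<in>{x. lt x z \<or> x = z}. {x, f x}| \<le>o m"
        by (intro K.UN_small K.down_small K.finite_small) auto
      ultimately show "h z \<in> K" "lt x z \<or> x = z \<Longrightarrow> lt x (h z) \<and> lt (f x) (h z)"
        using K.ub unfolding h_def by blast+
    qed
    define R where "R = {(i, j). ltJ i j}"
    define F where "F = wfrec R (\<lambda>F i. K.ub ((\<lambda>j. h (F j)) ` {j. ltJ j i}))"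
    have F_eq: "F i = K.ub ((\<lambda>j. h (F j)) ` {j. ltJ j i})" for i
    proof -
      have "(\<lambda>j. h (cut F R i j)) ` {j. ltJ j i} = (\<lambda>j. h (F j)) ` {j. ltJ j i}"
        by (auto simp: cut_def R_def)
      then show ?thesis
        using wfrec[of R "\<lambda>F i. K.ub ((\<lambda>j. h (F j)) ` {j. ltJ j i})" i] J.wf_lt
        unfolding F_def[symmetric] R_def[symmetric] by simp
    qed
    have seg: "|{j. ltJ j i}| \<le>o m" for i
      by (rule K.subset_small[OF J]) (use J.lt_in in blast)
    have F: "F i \<in> K \<and> (\<forall>j. ltJ j i \<longrightarrow> lt (h (F j)) (F i))" for i
    proof (induction i rule: wf_induct_rule[OF J.wf_lt])
      case (1 i)
      then have "(\<lambda>j. h (F j)) ` {j. ltJ j i} \<subseteq> K" using h by blast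
      then show ?case
        using K.ub[of "(\<lambda>j. h (F j)) ` {j. ltJ j i}"] K.image_small[OF seg] F_eq[of i] by auto
    qed
    have F_mono: "lt (F j) (F i)" if "ltJ j i" for i j
      using F[of i] F[of j] h(2) that K.trans by blast
    have "F ` J \<subseteq> K" using F by blast
    then have "\<exists>b\<in>K. \<forall>x\<in>F ` J. lt x b" using K.bounded K.image_small[OF J] by blast
    then obtain b where "b \<in> {b\<in>K. \<forall>i\<in>J. lt (F i) b}" by blast
    then obtain d where d: "d \<in> K" "\<And>i. i \<in> J \<Longrightarrow> lt (F i) d"
      and dmin: "\<And>x. lt x d \<Longrightarrow> x \<notin> {b\<in>K. \<forall>i\<in>J. lt (F i) b}"
      by (rule wfE_min[OF K.wf_lt]) auto
    have cofinal: "\<exists>i\<in>J. lt x (F i) \<or> x = F i" if "lt x d" for x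
      using dmin[OF that] K.not_lt F K.lt_in[OF that] by blast
    have "ladder d F" using d(2) F_mono cofinal unfolding ladder_def by blast
    moreover have "lt (f x) d" if x: "lt x d" for x
    proof -
      obtain i where i: "i \<in> J" "lt x (F i) \<or> x = F i" using cofinal[OF x] by blast
      obtain j where j: "j \<in> J" "ltJ i j"
        using J.bounded[of "{i}"] J.finite_small[of "{i}"] i(1) by auto
      have "lt (f x) (h (F i))" using h(2) F i(2) by blast
      then show ?thesis using F[of j] j d(2)[OF j(1)] K.trans by blast
    qed
    ultimately show ?thesis using d(1) unfolding S_def by blast
  qed
  have "ladder_system K lt m S (\<lambda>d. g d ` J) l"
  proof (intro ladder_system.intro[OF assms(1)] ladder_system_axioms.intro)
    show "S \<subseteq> K" by (auto simp: S_def)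
    show "lt z d" if "d \<in> S" "z \<in> g d ` J" for d z using lad(1) that by blast
    show "\<exists>z\<in>g d ` J. lt x z \<or> x = z" if "d \<in> S" "lt x d" for d x
      using lad(3)[OF that] by blast
  qed (fact bdd cof closed)+
  then show ?thesis by blast
qed

text \<open>A nonempty subset with at most \<lambda> elements is the range of a function from
  \<lambda> to \<open>X\<close>, and
  \<open>(2\<^sup>\<lambda>)\<^sup>\<lambda> = 2\<^sup>\<lambda>\<close>.\<close>

lemma card_small_subsets:
  fixes X :: "'k set" and l :: "'l rel"
  assumes l: "Card_order l" "infinite (Field l)" and X: "|X| \<le>o ctwo ^c l"
  shows "|{Q. Q \<subseteq> X \<and> |Q| \<le>o l}| \<le>o ctwo ^c l"
proof -
  have cinf: "Cinfinite l" using l by (simp add: cinfinite_def)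
  have fin: "Card_order (ctwo ^c l)" "infinite (Field (ctwo ^c l))"
    using Cinfinite_cexp[OF ordLeq_refl[OF Card_order_ctwo] cinf] by (auto simp: cinfinite_def)
  have "{Q. Q \<subseteq> X \<and> |Q| \<le>o l} \<subseteq> {{}} \<union> (\<lambda>f. f ` Field l) ` Func (Field l) X"
  proof
    fix Q assume Q: "Q \<in> {Q. Q \<subseteq> X \<and> |Q| \<le>o l}"
    show "Q \<in> {{}} \<union> (\<lambda>f. f ` Field l) ` Func (Field l) X"
    proof (cases "Q = {}")
      case False
      have "|Q| \<le>o |Field l|"
        using Q card_of_Field_ordIso[OF l(1)] ordIso_symmetric ordLeq_ordIso_trans by blast
      then obtain f where f: "f ` Field l = Q" using card_of_ordLeq2[OF False] by metis
      have "(\<lambda>x. if x \<in> Field l then f x else undefined) \<in> Func (Field l) X"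
        using f Q by (auto simp: Func_def)
      moreover have "(\<lambda>x. if x \<in> Field l then f x else undefined) ` Field l = Q"
        using f by auto
      ultimately show ?thesis by blast
    qed simp
  qed
  then have "|{Q. Q \<subseteq> X \<and> |Q| \<le>o l}| \<le>o |{{}} \<union> (\<lambda>f. f ` Field l) ` Func (Field l) X|"
    by (rule card_of_mono1)
  moreover have "|(\<lambda>f. f ` Field l) ` Func (Field l) X| \<le>o ctwo ^c l"
  proof -
    have "|(\<lambda>f. f ` Field l) ` Func (Field l) X| \<le>o |X| ^c l"
      using card_of_image[of _ "Func (Field l) X"] by (simp add: cexp_def Field_card_of)
    also have "|X| ^c l \<le>o (ctwo ^c l) ^c l" by (rule cexp_mono1[OF X l(1)])
    also have "(ctwo ^c l) ^c l =o ctwo ^c l"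
      by (rule cexp_cprod_ordLeq[OF Card_order_ctwo cinf Cinfinite_Cnotzero[OF cinf] ordLeq_refl[OF l(1)]])
    finally show ?thesis .
  qed
  moreover have "|{{}} :: 'k set set| \<le>o ctwo ^c l"
    using Card_order_singl_ordLeq[OF fin(1)] fin(2) by force
  ultimately show ?thesis
    using card_of_Un_ordLeq_infinite_Field[OF fin(2) _ _ fin(1)] ordLeq_transitive by blast
qed

lemma laddered_cardSuc_cexp:
  fixes lam :: "'l rel"
  assumes lam: "Card_order lam" "infinite (Field lam)" and kappa: "kappa = cardSuc (ctwo ^c lam)"
  obtains S A lo hi where
    "laddered_order (Field kappa) (\<lambda>x y. (x, y) \<in> kappa - Id) (ctwo ^c lam) S A lam lo hi"
proof -
  have cinf: "Cinfinite lam" using lam by (simp add: cinfinite_def)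
  have m: "Card_order (ctwo ^c lam)" "infinite (Field (ctwo ^c lam))"
    using Cinfinite_cexp[OF ordLeq_refl[OF Card_order_ctwo] cinf] by (auto simp: cinfinite_def)
  have less: "lam <o ctwo ^c lam" by (rule ordLess_ctwo_cexp[OF lam(1)])
  have K: "regular_order (Field kappa) (\<lambda>x y. (x, y) \<in> kappa - Id) (ctwo ^c lam)"
    unfolding kappa by (rule cardSuc_regular_order[OF m])
  have "cardSuc lam \<le>o ctwo ^c lam" by (rule cardSuc_least[OF lam(1) m(1) less])
  then have J: "|Field (cardSuc lam)| \<le>o ctwo ^c lam"
    using card_of_Field_ordIso[OF cardSuc_Card_order[OF lam(1)]] ordIso_ordLeq_trans by blast
  obtain S A where SA: "ladder_system (Field kappa) (\<lambda>x y. (x, y) \<in> kappa - Id) (ctwo ^c lam) S A lam"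
    using ladder_system_exists[OF K cardSuc_regular_order[OF lam] J] by blast
  have "infinite (Field kappa)" using cardSuc_finite[OF m(1)] m(2) kappa by simp
  then obtain h where h: "bij_betw h (Field kappa) (Field kappa \<times> Field kappa)"
    using card_of_Times_same_infinite ordIso_symmetric card_of_ordIso by metis
  have "laddered_order (Field kappa) (\<lambda>x y. (x, y) \<in> kappa - Id) (ctwo ^c lam) S A lam (fst \<circ> h) (snd \<circ> h)"
  proof (intro laddered_order.intro[OF SA] laddered_order_axioms.intro)
    show "bij_betw (\<lambda>x. ((fst \<circ> h) x, (snd \<circ> h) x)) (Field kappa) (Field kappa \<times> Field kappa)"
      using h by simp
  qed (fact lam ordLess_imp_ordLeq[OF less] card_small_subsets[OF lam])+
  then show thesis by (rule that)
qed

section \<open>The graph on \<kappa> and its copies of the transitive tree\<close>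

theorem theorem2p1:
  fixes lam :: "'l rel" and kappa :: "('l \<Rightarrow> bool) set rel"
  assumes "Card_order lam" and "infinite (Field lam)"
    and "kappa = cardSuc (ctwo ^c lam)"
  shows "\<exists>G :: ('l \<Rightarrow> bool) set graph.
           is_graph G \<and> |verts G| =o kappa \<and> arrows G (transitive_tree kappa) lam"
proof -
  obtain S A lo hi where
    "laddered_order (Field kappa) (\<lambda>x y. (x, y) \<in> kappa - Id) (ctwo ^c lam) S A lam lo hi"
    using laddered_cardSuc_cexp[OF assms] by metis
  then interpret laddered_order "Field kappa" "\<lambda>x y. (x, y) \<in> kappa - Id" "ctwo ^c lam" S A lam lo hi .
  have card: "Card_order kappa" using cardSuc_Card_order[OF m_card] assms(3) by simp
  have iso: "|Field kappa| =o kappa" by (rule card_of_Field_ordIso[OF card])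
  have "ctwo ^c lam \<le>o kappa" using cardSuc_ordLeq[OF m_card] assms(3) by simp
  then have lK: "lam \<le>o |Field kappa|"
    using l_le_m iso ordIso_symmetric ordLeq_ordIso_trans ordLeq_transitive by blast
  have adj_neq: "x \<noteq> t" if "adj x t" for x t
    using that adj_lo_hi[OF that] trans irrefl unfolding adj_def by blast
  define G where "G = (Field kappa, {{x, t} | x t. adj x t})"
  have "is_graph G"
    using adj_neq adj_in by (auto simp: is_graph_def G_def nsets_def)
  moreover have "|verts G| =o kappa" using iso by (simp add: G_def)
  moreover have "arrows G (transitive_tree kappa) lam"
    unfolding arrows_def
  proof (intro allI impI)
    fix c :: "('l \<Rightarrow> bool) set set \<Rightarrow> 'l"
    assume c: "c ` edges G \<subseteq> Field lam"
    have "c {x, t} \<in> Field lam" if "adj x t" for x t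
      using c that by (auto simp: G_def)
    then obtain a \<phi> where a: "a \<in> Field lam" and \<phi>:
      "inj_on \<phi> (lists (Field kappa))" "\<phi> ` lists (Field kappa) \<subseteq> Field kappa"
      "\<forall>s\<in>lists (Field kappa). \<forall>t\<in>lists (Field kappa).
        (strict_prefix s t \<longrightarrow> adj (\<phi> s) (\<phi> t) \<and> c {\<phi> s, \<phi> t} = a) \<and>
        (\<not> prefix s t \<longrightarrow> \<not> prefix t s \<longrightarrow> \<not> adj (\<phi> s) (\<phi> t))"
      using tree_copy[where col = "\<lambda>x t. c {x, t}", OF _ lK] by blast
    \<comment> \<open>Restricting the embedding to increasing sequences keeps the prefix relation,
      so the image of \<open>T\<close> induces the required tree.\<close>
    define T where "T = incr_seqs kappa"
    have T: "T \<subseteq> lists (Field kappa)" by (auto simp: T_def incr_seqs_def)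
    have inj: "inj_on \<phi> T" by (rule inj_on_subset[OF \<phi>(1) T])
    have pre: "adj (\<phi> s) (\<phi> t) \<and> c {\<phi> s, \<phi> t} = a" if "s \<in> T" "t \<in> T" "strict_prefix s t" for s t
      using \<phi>(3) T that by blast
    have comp: "strict_prefix s t \<or> strict_prefix t s" if "s \<in> T" "t \<in> T" "adj (\<phi> s) (\<phi> t)" for s t
    proof -
      have "prefix s t \<or> prefix t s" using \<phi>(3) T that by blast
      moreover have "s \<noteq> t" using adj_neq[OF that(3)] by blast
      ultimately show ?thesis by (auto simp: strict_prefix_def)
    qed
    define H where "H = (\<phi> ` T, edges G \<inter> [\<phi> ` T]\<^bsup>2\<^esup>)"
    have "induced_subgraph H G"
      using \<phi>(2) T by (auto simp: induced_subgraph_def H_def G_def)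
    moreover have "isomorphic H (transitive_tree kappa)"
      unfolding isomorphic_def
    proof (intro exI conjI ballI)
      show "bij_betw (inv_into T \<phi>) (verts H) (verts (transitive_tree kappa))"
        using inj_on_imp_bij_betw[OF inj] bij_betw_inv_into
        by (simp add: H_def transitive_tree_def T_def)
      fix u v assume "u \<in> verts H" "v \<in> verts H"
      then obtain s t where st: "s \<in> T" "t \<in> T" "u = \<phi> s" "v = \<phi> t" by (auto simp: H_def)
      have "{u, v} \<in> edges G \<longleftrightarrow> adj u v \<or> adj v u"
        unfolding G_def by (auto simp: doubleton_eq_iff)
      moreover have "{u, v} \<in> [\<phi> ` T]\<^bsup>2\<^esup>" if "adj u v \<or> adj v u"
      proof -
        have "u \<noteq> v" using that adj_neq by blast
        then show ?thesis using st by (simp add: nsets_def)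
      qed
      ultimately have "{u, v} \<in> edges H \<longleftrightarrow> adj u v \<or> adj v u"
        unfolding H_def by auto
      also have "\<dots> \<longleftrightarrow> strict_prefix s t \<or> strict_prefix t s"
        using st comp[of s t] comp[of t s] pre[of s t] pre[of t s] by blast
      also have "\<dots> \<longleftrightarrow> {s, t} \<in> edges (transitive_tree kappa)"
        using st(1,2) by (auto simp: transitive_tree_def T_def doubleton_eq_iff)
      finally show "{u, v} \<in> edges H \<longleftrightarrow> {inv_into T \<phi> u, inv_into T \<phi> v} \<in> edges (transitive_tree kappa)"
        using st inj by (simp add: inv_into_f_f)
    qed
    moreover have "\<forall>e\<in>edges H. c e = a"
    proof
      fix e assume e: "e \<in> edges H"
      then obtain x y where xy: "e = {x, y}" "adj x y" by (auto simp: H_def G_def)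
      moreover from e xy(1) have "x \<in> \<phi> ` T" "y \<in> \<phi> ` T" by (auto simp: H_def nsets_def)
      ultimately obtain s t where st: "s \<in> T" "t \<in> T" "e = {\<phi> s, \<phi> t}" "adj (\<phi> s) (\<phi> t)" by blast
      then show "c e = a"
        using comp[OF st(1,2,4)] pre[of s t] pre[of t s] by (auto simp: insert_commute)
    qed
    ultimately show "\<exists>H. induced_subgraph H G \<and> isomorphic H (transitive_tree kappa) \<and>
        (\<exists>a\<in>Field lam. \<forall>e\<in>edges H. c e = a)"
      using a by blast
  qed
  ultimately show ?thesis by blast
qed

end
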